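(* For any integer $p\geqslant 1$ define $$R_{p}:=\frac{(-1)^{p-1}}{2p\cdot 8^{p}}\left\{1+\sum_{k=1}^{p}\binom{p}{k}(-4)^{k}B_{2k}\left(\tfrac{1}{2}\right)\right\},$$ where $B_{2k}(x)$ is the Bernoulli polynomial of order $2k$. Let $n$ be a positive integer and put $$m:=\frac{n(n+1)}{2}.$$ Then, for every integer $r\geqslant 1$, there exists a real number $\Theta_r$ (which may depend on $n$ as well as on $r$) with $0<\Theta_r<1$ such that $$1+\frac{1}{2}+\frac{1}{3}+\cdots+\frac{1}{n}=\frac{1}{2}\ln(2m)+\gamma+\sum_{p=1}^{r}\frac{R_{p}}{m^{p}}+\Theta_r\cdot\frac{R_{r+1}}{m^{r+1}},$$ where $\gamma$ is Euler's constant.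
   Context: $B_j(x)$ denotes the $j$-th Bernoulli polynomial, given by $\frac{te^{xt}}{e^t-1}=\sum_{j\ge 0}B_j(x)\frac{t^j}{j!}$ (so, e.g., $B_2(x)=x^2-x+\frac16$ and $B_2(\frac12)=-\frac1{12}$). $\gamma=\lim_{n\to\infty}\left(\sum_{k=1}^n\frac1k-\ln n\right)=0.57721\cdots$ is Euler's constant, and $\ln$ is the natural logarithm. *)

theory Defs
  imports "HOL-Analysis.Analysis" "HOL-Computational_Algebra.Formal_Power_Series"
begin

text \<open>
  The quotient below is taken in the ring of formal power series. Its divisor has subdegree 1,
  which cancels against the factor \<open>fps_X\<close>, so this is the exact quotient.
\<close>

definition bernoulli_poly :: "nat \<Rightarrow> real \<Rightarrow> real" where
  "bernoulli_poly j x = fact j * fps_nth (fps_X * fps_exp x / (fps_exp 1 - 1)) j"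

definition ramanujan_coeff :: "nat \<Rightarrow> real" where
  "ramanujan_coeff p =
     (-1) ^ (p - 1) / (2 * real p * 8 ^ p) *
       (1 + (\<Sum>k = 1..p. real (p choose k) * (-4) ^ k * bernoulli_poly (2 * k) (1 / 2)))"

end

theory Submission
  imports
    Defs
    "HOL-Complex_Analysis.Residue_Theorem"
    "HOL-Probability.Sinc_Integral"
    "HOL-Real_Asymp.Real_Asymp"
begin

text \<open>
  Let \<open>T\<close> be a real random variable with density \<open>\<pi> / (2 cosh\<^sup>2 (\<pi> t))\<close>. Integrating
  \<open>\<pi> f(z) / (2 sin\<^sup>2 (\<pi> z))\<close> along the lines \<open>Re z = \<plusminus>1/2\<close> and picking up the residue at \<open>0\<close>
  gives \<open>E (f (1/2 + iT) - f (-1/2 + iT)) = f' 0\<close>. Taking \<open>f z = z ^ j\<close> identifies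
  \<open>E (iT) ^ j\<close> with \<open>B\<^sub>j(1/2)\<close>; taking \<open>f z = Ln (n + z)\<close> and telescoping gives
  \<open>H\<^sub>n - \<gamma> = E (ln ((n + 1/2)\<^sup>2 + T\<^sup>2) / 2)\<close>. Since \<open>(n + 1/2)\<^sup>2 = 2m + 1/4\<close>, this says
  \<open>H\<^sub>n - \<gamma> - ln (2m) / 2 = E (ln (1 + Y / (2m)) / 2)\<close> with \<open>Y = T\<^sup>2 + 1/4 > 0\<close>. The Taylor
  polynomials of \<open>ln (1 + y)\<close> strictly envelop it for \<open>y > 0\<close>, and their means are the partial
  sums of the expansion, because \<open>R\<^sub>p = (-1) ^ (p - 1) / (2p) E (Y / 2) ^ p\<close>.
\<close>

subsection \<open>The density and a contour integral\<close>

text \<open>This is the logistic density of scale 1/(2 pi). It is also the weight that pi / (2 sin^2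
  (pi z)) takes on both lines Re z = 1/2 and Re z = -1/2.\<close>

definition sech_density :: "real \<Rightarrow> real" where
  "sech_density t = pi / (2 * (cosh (pi * t))\<^sup>2)"

lemma sech_density_pos: "sech_density t > 0"
  by (simp add: sech_density_def zero_less_divide_iff)

lemma continuous_on_sech_density [continuous_intros]: "continuous_on A sech_density"
  unfolding sech_density_def by (intro continuous_intros) auto

lemma measurable_sech_density [measurable]: "sech_density \<in> borel_measurable borel"
  by (intro borel_measurable_continuous_onI continuous_intros)

lemma cosh_ge_exp_abs_half: "cosh (x::real) \<ge> exp \<bar>x\<bar> / 2"
proof -
  have "cosh x = cosh \<bar>x\<bar>"
    by (simp add: abs_if)
  also have "\<dots> \<ge> exp \<bar>x\<bar> / 2"
    by (simp add: cosh_field_def)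
  finally show ?thesis .
qed

lemma power_le_fact_mult_exp:
  assumes "x \<ge> (0::real)"
  shows "x ^ k \<le> fact k * exp x"
proof -
  have "(\<Sum>n\<in>{k}. x ^ n /\<^sub>R fact n) \<le> (\<Sum>n. x ^ n /\<^sub>R fact n)"
    using assms by (intro sum_le_suminf summable_exp_generic) auto
  thus ?thesis
    by (simp add: exp_def field_simps)
qed

text \<open>The density decays like exp (-2 pi |t|), which beats every polynomial. Bounding k + 2
  powers by the exponential leaves two spare powers to pay for 1 + t^2, so a multiple of the
  integrable Cauchy kernel dominates.\<close>

lemma sech_density_le:
  "(1 + \<bar>t\<bar>) ^ k * sech_density t \<le> 2 * pi * exp 1 * fact (k + 2) * inverse (1 + t\<^sup>2)"
proof -
  have "(1 + \<bar>t\<bar>) ^ k * (1 + t\<^sup>2) \<le> (1 + \<bar>t\<bar>) ^ k * (1 + \<bar>t\<bar>)\<^sup>2"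
    by (intro mult_left_mono) (auto simp: power2_eq_square algebra_simps)
  also have "\<dots> = (1 + \<bar>t\<bar>) ^ (k + 2)"
    by (simp only: power_add)
  also have "\<dots> \<le> fact (k + 2) * exp (1 + \<bar>t\<bar>)"
    by (rule power_le_fact_mult_exp) auto
  also have "\<dots> = fact (k + 2) * exp 1 * exp \<bar>t\<bar>"
    by (simp add: exp_add)
  also have "\<dots> \<le> fact (k + 2) * exp 1 * exp (2 * \<bar>pi * t\<bar>)"
  proof -
    have "1 * \<bar>t\<bar> \<le> (2 * pi) * \<bar>t\<bar>"
      using pi_gt3 by (intro mult_right_mono) auto
    thus ?thesis by (simp add: abs_mult)
  qed
  also have "\<dots> \<le> fact (k + 2) * exp 1 * (4 * (cosh (pi * t))\<^sup>2)"
  proof -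
    have "(exp \<bar>pi * t\<bar> / 2)\<^sup>2 \<le> (cosh (pi * t))\<^sup>2"
      by (intro power_mono cosh_ge_exp_abs_half) auto
    moreover have "(exp \<bar>pi * t\<bar> / 2)\<^sup>2 = exp (2 * \<bar>pi * t\<bar>) / 4"
      by (simp add: power_divide exp_double)
    ultimately show ?thesis
      by (intro mult_left_mono) auto
  qed
  finally have *: "(1 + \<bar>t\<bar>) ^ k * (1 + t\<^sup>2) \<le> fact (k + 2) * exp 1 * (4 * (cosh (pi * t))\<^sup>2)" .
  have "1 + t\<^sup>2 > 0"
    by (simp add: add_pos_nonneg)
  hence "(1 + \<bar>t\<bar>) ^ k \<le> fact (k + 2) * exp 1 * (4 * (cosh (pi * t))\<^sup>2) * inverse (1 + t\<^sup>2)"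
    using * by (simp add: field_simps)
  hence "(1 + \<bar>t\<bar>) ^ k * sech_density t \<le>
           fact (k + 2) * exp 1 * (4 * (cosh (pi * t))\<^sup>2) * inverse (1 + t\<^sup>2) * sech_density t"
    using sech_density_pos[of t] by (intro mult_right_mono) auto
  also have "\<dots> = 2 * pi * exp 1 * fact (k + 2) * inverse (1 + t\<^sup>2)"
    by (simp add: sech_density_def)
  finally show ?thesis .
qed

text \<open>Stated for vector-valued \<open>h\<close> because it serves both the complex boundary
  values of \<open>f\<close> and real integrands.\<close>

lemma integrable_sech_density:
  fixes h :: "real \<Rightarrow> 'a :: {banach, second_countable_topology}"
  assumes [measurable]: "h \<in> borel_measurable borel"
    and bound: "\<And>t. norm (h t) \<le> C * (1 + \<bar>t\<bar>) ^ k"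
  shows "integrable lborel (\<lambda>t. sech_density t *\<^sub>R h t)"
proof -
  have C: "C \<ge> 0"
    using order_trans[OF norm_ge_zero bound[of 0]] by simp
  have "integrable lborel (\<lambda>t::real. inverse (1 + t\<^sup>2))"
    using integrable_inverse_1_plus_square by (simp add: set_integrable_def)
  hence "integrable lborel (\<lambda>t. C * (2 * pi * exp 1 * fact (k + 2) * inverse (1 + t\<^sup>2)))"
    by (intro integrable_mult_right)
  thus ?thesis
  proof (rule Bochner_Integration.integrable_bound)
    show "AE t in lborel. norm (sech_density t *\<^sub>R h t)
        \<le> norm (C * (2 * pi * exp 1 * fact (k + 2) * inverse (1 + t\<^sup>2)))"
    proof (intro AE_I2)
      fix t :: real
      have "norm (sech_density t *\<^sub>R h t) \<le> sech_density t * (C * (1 + \<bar>t\<bar>) ^ k)"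
        using sech_density_pos[of t] bound[of t] by simp
      also have "\<dots> = C * ((1 + \<bar>t\<bar>) ^ k * sech_density t)"
        by simp
      also have "\<dots> \<le> C * (2 * pi * exp 1 * fact (k + 2) * inverse (1 + t\<^sup>2))"
        using C by (intro mult_left_mono sech_density_le)
      finally show "norm (sech_density t *\<^sub>R h t)
        \<le> norm (C * (2 * pi * exp 1 * fact (k + 2) * inverse (1 + t\<^sup>2)))"
        using C by (simp only: abs_mult real_norm_def abs_of_nonneg) simp
    qed
  qed simp
qed

section \<open>Contour integration in the strip |Re z| < 1\<close>

lemma sin_pi_nonzero_in_strip:
  assumes "-1 < Re z" "Re z < 1" "z \<noteq> 0"
  shows "sin (of_real pi * z) \<noteq> 0"
proof
  assume "sin (of_real pi * z) = 0"
  then obtain n :: int where "of_real pi * z = of_real (of_int n * pi)"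
    unfolding sin_eq_0 by auto
  hence "z = of_int n" by simp
  hence "n = 0 " using assms by auto
  thus False using \<open>z = of_int n\<close> assms by simp
qed

text \<open>Near 0 the integrand is f(z) / (2 pi z^2) plus a holomorphic term, so its residue is
  f'(0) / (2 pi), and 0 is the only pole in the strip.\<close>

lemma contour_integral_over_sin_squared:
  fixes f :: "complex \<Rightarrow> complex"
  assumes f: "f holomorphic_on {z. -1 < Re z \<and> Re z < 1}" and R: "R > 0"
  shows "contour_integral (rectpath (Complex (-1/2) (-R)) (Complex (1/2) R))
           (\<lambda>z. of_real pi * f z / (2 * (sin (of_real pi * z))\<^sup>2)) = \<i> * deriv f 0"
proof -
  define S where "S = {z. -1 < Re z \<and> Re z < 1}"
  define g where "g = rectpath (Complex (-1/2) (-R)) (Complex (1/2) R)"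
  have S_eq: "S = {z. -1 < Re z} \<inter> {z. Re z < 1}"
    by (auto simp: S_def)
  have "open S" "convex S"
    unfolding S_eq by (auto intro!: open_Int open_halfspace_Re_gt open_halfspace_Re_lt
      convex_Int convex_halfspace_Re_gt convex_halfspace_Re_lt)
  have f': "f holomorphic_on S" using f by (simp add: S_def)
  have nz: "sin (of_real pi * z) \<noteq> 0" if "z \<in> S - {0}" for z
    using that sin_pi_nonzero_in_strip[of z] by (auto simp: S_def)
  have g: "valid_path g" "pathfinish g = pathstart g" "path_image g \<subseteq> S - {0}"
    using R by (auto simp: g_def path_image_rectpath S_def)
  text \<open>Integration by parts against the cotangent lowers the double pole to a simple one.\<close>
  define F where "F = (\<lambda>z::complex. f z * cos (of_real pi * z) / sin (of_real pi * z))"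
  define G where "G = (\<lambda>z::complex. deriv f z * cos (of_real pi * z) / sin (of_real pi * z))"
  define H where "H = (\<lambda>z::complex. of_real pi * f z / (2 * (sin (of_real pi * z))\<^sup>2))"
  have holoG: "G holomorphic_on S - {0}"
    unfolding G_def using nz \<open>open S\<close>
    by (intro holomorphic_intros holomorphic_on_subset[OF holomorphic_deriv[OF f']]) auto
  have contH: "H holomorphic_on S - {0}"
    unfolding H_def using nz by (intro holomorphic_intros holomorphic_on_subset[OF f']) auto
  have "((\<lambda>z. G z - 2 * H z) has_contour_integral 0) g"
  proof (rule Cauchy_theorem_primitive)
    fix z assume z: "z \<in> S - {0}"
    let ?s = "sin (of_real pi * z)" and ?c = "cos (of_real pi * z)"
    have "(f has_field_derivative deriv f z) (at z within S - {0})"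
      using z \<open>open S\<close> f' by (auto intro: holomorphic_derivI)
    hence "(F has_field_derivative ((deriv f z * ?c - f z * (?s * of_real pi)) * ?s -
             f z * ?c * (?c * of_real pi)) / (?s * ?s)) (at z within S - {0})"
      unfolding F_def using nz[OF z] by (auto intro!: derivative_eq_intros)
    also have "(deriv f z * ?c - f z * (?s * of_real pi)) * ?s - f z * ?c * (?c * of_real pi) =
                 deriv f z * ?c * ?s - of_real pi * f z * (?s\<^sup>2 + ?c\<^sup>2)"
      by (simp only: power2_eq_square algebra_simps)
    also have "\<dots> / (?s * ?s) = G z - 2 * H z"
      using nz[OF z] by (simp add: G_def H_def diff_divide_distrib) (simp add: power2_eq_square)
    finally show "(F has_field_derivative G z - 2 * H z) (at z within S - {0})" .
  qed (use g in auto)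
  hence "contour_integral g (\<lambda>z. G z - 2 * H z) = 0"
    by (rule contour_integral_unique)
  moreover have "G contour_integrable_on g" "H contour_integrable_on g"
    using contour_integrable_holomorphic_simple[OF _ _ g(1,3)] holoG contH \<open>open S\<close> by auto
  ultimately have "2 * contour_integral g H = contour_integral g G"
    by (simp add: contour_integral_diff contour_integrable_lmul contour_integral_lmul)
  also have "contour_integral g G = 2 * pi * \<i> * (\<Sum>p\<in>{0}. winding_number g p * residue G p)"
  proof (rule Residue_theorem)
    show "\<forall>z. z \<notin> S \<longrightarrow> winding_number g z = 0"
    proof (intro allI impI)
      fix z assume "z \<notin> S"
      thus "winding_number g z = 0" unfolding g_def using R
        by (intro winding_number_rectpath_outside) (auto simp: in_cbox_complex_iff S_def)
    qed
  qed (use holoG g \<open>open S\<close> \<open>convex S\<close> convex_connected in auto)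
  also have "\<dots> = 2 * pi * \<i> * (winding_number g 0 * residue G 0)"
    by simp
  also have "winding_number g 0 = 1"
    unfolding g_def using R by (intro winding_number_rectpath) (auto simp: in_box_complex_iff)
  also have "residue G 0 = deriv f 0 / of_real pi"
  proof (rule residue_simple')
    have "((\<lambda>z::complex. sin (of_real pi * z) / z) \<longlongrightarrow> of_real pi) (at 0)"
    proof -
      have "((\<lambda>z. sin (of_real pi * z)) has_field_derivative of_real pi) (at (0::complex))"
        by (auto intro!: derivative_eq_intros)
      thus ?thesis by (simp add: DERIV_def)
    qed
    moreover have "(deriv f \<longlongrightarrow> deriv f 0) (at 0)"
      using holomorphic_on_imp_continuous_on[OF holomorphic_deriv[OF f' \<open>open S\<close>]] \<open>open S\<close>
      by (simp add: continuous_on_eq_continuous_at S_def isCont_def)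
    ultimately have "((\<lambda>z. deriv f z * cos (of_real pi * z) / (sin (of_real pi * z) / z)) \<longlongrightarrow>
            deriv f 0 * cos (of_real pi * 0) / of_real pi) (at 0)"
      by (intro tendsto_intros) auto
    thus "((\<lambda>z. G z * (z - 0)) \<longlongrightarrow> deriv f 0 / of_real pi) (at 0)"
      by (simp add: G_def)
  qed (use \<open>open S\<close> holoG in \<open>auto simp: S_def\<close>)
  finally show ?thesis
    by (simp add: H_def g_def)
qed

text \<open>The two sides differ by sin^2 (Re z). The bound makes the integrand exponentially small
  on the horizontal sides of a tall rectangle.\<close>

lemma sinh_sq_le_norm_sin_sq:
  "(sinh (Im z))\<^sup>2 \<le> (norm (sin z))\<^sup>2"
proof -
  have "(sinh (Im z))\<^sup>2 = (exp (2 * Im z) + inverse (exp (2 * Im z)) - 2) / 4"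
    by (simp only: sinh_field_def exp_double exp_minus) (simp add: power2_eq_square field_simps)
  also have "\<dots> \<le> (norm (sin z))\<^sup>2"
    unfolding norm_sin_squared by simp
  finally show ?thesis .
qed

text \<open>A shift by pi/2 in either direction turns the sine into a cosine up to sign, and
  squaring removes the sign. Hence both vertical lines carry the same weight.\<close>

lemma sin_pi_half_plus_imaginary:
  "(sin (of_real pi * Complex (1/2) t))\<^sup>2 = of_real ((cosh (pi * t))\<^sup>2)"
  "(sin (of_real pi * Complex (-(1/2)) t))\<^sup>2 = of_real ((cosh (pi * t))\<^sup>2)"
proof -
  have c: "cos (\<i> * (of_real pi * of_real t)) = complex_of_real (cosh (pi * t))"
    unfolding cosh_conv_cos [symmetric] of_real_mult [symmetric]
    by (simp add: cosh_field_def flip: exp_of_real)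
  have 1: "of_real pi * Complex (1/2) t = of_real pi / 2 + \<i> * (of_real pi * of_real t)"
    and 2: "of_real pi * Complex (-(1/2)) t = \<i> * (of_real pi * of_real t) - of_real pi / 2"
    by (simp_all add: complex_eq_iff)
  show "(sin (of_real pi * Complex (1/2) t))\<^sup>2 = of_real ((cosh (pi * t))\<^sup>2)"
    unfolding 1 by (simp add: sin_add c)
  show "(sin (of_real pi * Complex (-(1/2)) t))\<^sup>2 = of_real ((cosh (pi * t))\<^sup>2)"
    unfolding 2 by (simp add: sin_diff c)
qed

lemma tendsto_power_over_sinh_sq:
  "(\<lambda>n. (1 + real n) ^ k / (sinh (pi * real n))\<^sup>2) \<longlonglongrightarrow> 0"
  by real_asymp

lemma continuous_on_Complex_line: "continuous_on A (Complex c)"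
  unfolding Complex_eq by (intro continuous_intros)

text \<open>The height of the rectangle tends to infinity: the vertical sides produce the integral,
  while polynomial growth of \<open>f\<close> cannot compensate the decay of 1 / sin^2 on the
  horizontal sides.\<close>

lemma integral_sech_density_diff:
  fixes f :: "complex \<Rightarrow> complex"
  assumes f: "f holomorphic_on {z. -1 < Re z \<and> Re z < 1}"
    and bound: "\<And>z. \<bar>Re z\<bar> \<le> 1/2 \<Longrightarrow> norm (f z) \<le> C * (1 + \<bar>Im z\<bar>) ^ k"
  shows "(\<integral>t. sech_density t *\<^sub>R (f (Complex (1/2) t) - f (Complex (-(1/2)) t)) \<partial>lborel) = deriv f 0"
proof -
  define S where "S = {z. -1 < Re z \<and> Re z < 1}"
  define H where "H = (\<lambda>z::complex. of_real pi * f z / (2 * (sin (of_real pi * z))\<^sup>2))"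
  define h where "h = (\<lambda>t. f (Complex (1/2) t) - f (Complex (-(1/2)) t))"
  have f': "f holomorphic_on S" using f by (simp add: S_def)
  have C: "C \<ge> 0"
    using order_trans[OF norm_ge_zero bound[of 0]] by simp
  have nz: "sin (of_real pi * z) \<noteq> 0" if "z \<in> S - {0}" for z
    using that sin_pi_nonzero_in_strip[of z] by (auto simp: S_def)
  have holoH: "H holomorphic_on S - {0}"
    unfolding H_def using nz by (intro holomorphic_intros holomorphic_on_subset[OF f']) auto
  have contH: "continuous_on (S - {0}) H"
    by (rule holomorphic_on_imp_continuous_on[OF holoH])
  have cont: "continuous_on A (\<lambda>t. f (Complex c t))" if "\<bar>c\<bar> \<le> 1/2" for c A
    by (rule continuous_on_compose2[OF holomorphic_on_imp_continuous_on[OF f'] continuous_on_Complex_line])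
       (use that in \<open>auto simp: S_def\<close>)
  have conth: "continuous_on A h" for A
    unfolding h_def by (intro continuous_intros cont) auto
  have [measurable]: "h \<in> borel_measurable borel"
    by (intro borel_measurable_continuous_onI conth)
  have int: "integrable lborel (\<lambda>t. sech_density t *\<^sub>R h t)"
  proof (rule integrable_sech_density)
    fix t :: real
    have "norm (h t) \<le> norm (f (Complex (1/2) t)) + norm (f (Complex (-(1/2)) t))"
      unfolding h_def by (rule norm_triangle_ineq4)
    also have "\<dots> \<le> C * (1 + \<bar>t\<bar>) ^ k + C * (1 + \<bar>t\<bar>) ^ k"
      using bound[of "Complex (1/2) t"] bound[of "Complex (-(1/2)) t"] by (intro add_mono) auto
    finally show "norm (h t) \<le> (2 * C) * (1 + \<bar>t\<bar>) ^ k" by simp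
  qed simp
  define V where "V = (\<lambda>R. integral {-R..R} (\<lambda>t. sech_density t *\<^sub>R h t))"
  have est: "norm (V R - deriv f 0) \<le> pi * C * ((1 + R) ^ k / (sinh (pi * R))\<^sup>2)" if R: "R > 0" for R
  proof -
    let ?a1 = "Complex (-(1/2)) (-R)" and ?a2 = "Complex (1/2) (-R)"
      and ?a3 = "Complex (1/2) R" and ?a4 = "Complex (-(1/2)) R"
    \<comment> \<open>\<open>B\<close> bounds the integrand on one horizontal side. Both have length
      1, so together they contribute at most 2 \<open>B\<close>, the claimed error.\<close>
    define B where "B = pi * C * ((1 + R) ^ k / (sinh (pi * R))\<^sup>2) / 2"
    have B: "B \<ge> 0" using C R by (simp add: B_def)
    have seg: "closed_segment ?a1 ?a2 \<subseteq> S - {0}" "closed_segment ?a2 ?a3 \<subseteq> S - {0}"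
      "closed_segment ?a3 ?a4 \<subseteq> S - {0}" "closed_segment ?a1 ?a4 \<subseteq> S - {0}" "closed_segment ?a4 ?a1 \<subseteq> S - {0}"
      using R by (auto simp: closed_segment_same_Re closed_segment_same_Im S_def closed_segment_eq_real_ivl)
    have ci: "H contour_integrable_on linepath a b" if "closed_segment a b \<subseteq> S - {0}" for a b
      by (intro contour_integrable_continuous_linepath continuous_on_subset[OF contH] that)
    have Hb: "norm (H z) \<le> B" if "\<bar>Re z\<bar> \<le> 1/2" "\<bar>Im z\<bar> = R" for z
    proof -
      have "0 < sinh (pi * R)" using R by simp
      moreover have "(sinh (pi * R))\<^sup>2 = (sinh (Im (of_real pi * z)))\<^sup>2"
        using that(2) by (auto simp: abs_if split: if_splits)
      hence "(sinh (pi * R))\<^sup>2 \<le> (norm (sin (of_real pi * z)))\<^sup>2"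
        by (simp only: sinh_sq_le_norm_sin_sq)
      moreover have "norm (f z) \<le> C * (1 + R) ^ k"
        using bound[OF that(1)] that(2) by simp
      ultimately have "norm (f z) / (norm (sin (of_real pi * z)))\<^sup>2 \<le> C * (1 + R) ^ k / (sinh (pi * R))\<^sup>2"
        using C R by (intro frac_le) auto
      hence "pi / 2 * (norm (f z) / (norm (sin (of_real pi * z)))\<^sup>2) \<le> pi / 2 * (C * (1 + R) ^ k / (sinh (pi * R))\<^sup>2)"
        by (intro mult_left_mono) auto
      thus ?thesis
        by (simp add: H_def B_def norm_divide norm_mult norm_power)
    qed
    have horiz: "norm (contour_integral (linepath ?a1 ?a2) H) \<le> B * norm (?a2 - ?a1)"
      "norm (contour_integral (linepath ?a3 ?a4) H) \<le> B * norm (?a4 - ?a3)"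
      by (intro contour_integral_bound_linepath ci seg B Hb;
          use R in \<open>auto simp: closed_segment_same_Im closed_segment_eq_real_ivl\<close>)+
    have nrm: "norm (?a2 - ?a1) = 1" "norm (?a4 - ?a3) = 1"
      by (simp_all add: cmod_def)
    have Hline: "H (Complex (1/2) t) = sech_density t *\<^sub>R f (Complex (1/2) t)"
      "H (Complex (-(1/2)) t) = sech_density t *\<^sub>R f (Complex (-(1/2)) t)" for t
      unfolding H_def sin_pi_half_plus_imaginary sech_density_def by (simp_all add: scaleR_conv_of_real)
    have i: "(\<lambda>t. sech_density t *\<^sub>R f (Complex c t)) integrable_on {-R..R}" if "\<bar>c\<bar> \<le> 1/2" for c
      by (intro integrable_continuous_interval continuous_intros cont that)
    have "\<i> * deriv f 0 = contour_integral (rectpath ?a1 ?a3) H"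
      using contour_integral_over_sin_squared[OF f R] unfolding H_def by simp
    also have "\<dots> = contour_integral (linepath ?a1 ?a2) H + contour_integral (linepath ?a2 ?a3) H
        + contour_integral (linepath ?a3 ?a4) H + contour_integral (linepath ?a4 ?a1) H"
      unfolding rectpath_def Let_def
      by (simp add: ci seg contour_integrable_join)
    \<comment> \<open>The left side is traversed downwards. Reversing it allows the parametrization
      by increasing imaginary part and yields the minus sign in \<open>h\<close>.\<close>
    also have "contour_integral (linepath ?a4 ?a1) H = - contour_integral (linepath ?a1 ?a4) H"
      by (intro contour_integral_reverse_linepath continuous_on_subset[OF contH] seg)
    also have "contour_integral (linepath ?a1 ?a4) H = \<i> * integral {-R..R} (\<lambda>t. H (Complex (-(1/2)) t))"
      using R by (intro contour_integral_linepath_same_Re) auto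
    also have "contour_integral (linepath ?a2 ?a3) H = \<i> * integral {-R..R} (\<lambda>t. H (Complex (1/2) t))"
      using R by (intro contour_integral_linepath_same_Re) auto
    finally have "\<i> * deriv f 0 = contour_integral (linepath ?a1 ?a2) H + contour_integral (linepath ?a3 ?a4) H
       + \<i> * (integral {-R..R} (\<lambda>t. H (Complex (1/2) t)) - integral {-R..R} (\<lambda>t. H (Complex (-(1/2)) t)))"
      by (simp add: algebra_simps)
    also have "integral {-R..R} (\<lambda>t. H (Complex (1/2) t)) - integral {-R..R} (\<lambda>t. H (Complex (-(1/2)) t)) = V R"
      unfolding Hline V_def h_def scaleR_diff_right
      by (intro Henstock_Kurzweil_Integration.integral_diff [symmetric] i) auto
    finally have "\<i> * (V R - deriv f 0) = - (contour_integral (linepath ?a1 ?a2) H + contour_integral (linepath ?a3 ?a4) H)"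
      by (simp add: algebra_simps)
    hence "norm (\<i> * (V R - deriv f 0)) = norm (contour_integral (linepath ?a1 ?a2) H + contour_integral (linepath ?a3 ?a4) H)"
      by (simp only: norm_minus_cancel)
    also have "\<dots> \<le> B + B"
      using horiz unfolding nrm by (intro norm_triangle_mono) auto
    finally show ?thesis by (simp add: norm_mult B_def mult_ac)
  qed
  have "(\<lambda>n. V (real n) - deriv f 0) \<longlonglongrightarrow> 0"
  proof (rule Lim_null_comparison)
    show "\<forall>\<^sub>F n in sequentially. norm (V (real n) - deriv f 0) \<le> pi * C * ((1 + real n) ^ k / (sinh (pi * real n))\<^sup>2)"
      using eventually_gt_at_top[of 0] by eventually_elim (rule est, simp)
    show "(\<lambda>n. pi * C * ((1 + real n) ^ k / (sinh (pi * real n))\<^sup>2)) \<longlonglongrightarrow> 0"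
      by (rule tendsto_mult_right_zero[OF tendsto_power_over_sinh_sq])
  qed
  hence "(\<lambda>n. V (real n)) \<longlonglongrightarrow> deriv f 0"
    by (simp add: LIM_zero_iff)
  \<comment> \<open>By dominated convergence the truncated integrals also tend to the integral over
    the whole line, so the two limits agree.\<close>
  moreover have "(\<lambda>n. V (real n)) \<longlonglongrightarrow> (\<integral>t. sech_density t *\<^sub>R h t \<partial>lborel)"
  proof -
    have "V (real n) = (\<integral>t. indicator {-real n..real n} t *\<^sub>R (sech_density t *\<^sub>R h t) \<partial>lborel)" for n
    proof -
      have "set_integrable lborel {-real n..real n} (\<lambda>t. sech_density t *\<^sub>R h t)"
        by (intro borel_integrable_atLeastAtMost' continuous_intros conth)
      from set_borel_integral_eq_integral(2)[OF this] show ?thesis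
        unfolding V_def set_lebesgue_integral_def by simp
    qed
    moreover have "(\<lambda>n. \<integral>t. indicator {-real n..real n} t *\<^sub>R (sech_density t *\<^sub>R h t) \<partial>lborel)
        \<longlonglongrightarrow> (\<integral>t. sech_density t *\<^sub>R h t \<partial>lborel)"
    proof (rule integral_dominated_convergence[where w = "\<lambda>t. norm (sech_density t *\<^sub>R h t)"])
      show "AE t in lborel. (\<lambda>n. indicator {-real n..real n} t *\<^sub>R (sech_density t *\<^sub>R h t)) \<longlonglongrightarrow> sech_density t *\<^sub>R h t"
      proof (intro AE_I2 tendsto_eventually)
        fix t :: real
        obtain N :: nat where N: "\<bar>t\<bar> \<le> real N" using real_arch_simple by blast
        show "\<forall>\<^sub>F n in sequentially. indicator {-real n..real n} t *\<^sub>R (sech_density t *\<^sub>R h t) = sech_density t *\<^sub>R h t"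
          using eventually_ge_at_top[of N]
        proof eventually_elim
          case (elim n)
          hence "real N \<le> real n" by simp
          hence "t \<in> {-real n..real n}" using N by auto
          thus ?case by simp
        qed
      qed
    qed (use integrable_norm[OF int] in \<open>auto simp: indicator_def\<close>)
    ultimately show ?thesis by simp
  qed
  ultimately show ?thesis
    using LIMSEQ_unique unfolding h_def by blast
qed

subsection \<open>Moments and Bernoulli polynomials\<close>

text \<open>Expectation of h(T). That the total mass is 1 is not built in; it comes out of the
  contour identity in \<open>sech_moment_0\<close>.\<close>

definition sech_mean :: "(real \<Rightarrow> real) \<Rightarrow> real" where
  "sech_mean h = (\<integral>t. sech_density t * h t \<partial>lborel)"

definition sech_integrable :: "(real \<Rightarrow> real) \<Rightarrow> bool" where
  "sech_integrable h \<longleftrightarrow> integrable lborel (\<lambda>t. sech_density t * h t)"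

lemma sech_integrable_polynomially_bounded:
  assumes "h \<in> borel_measurable borel" "\<And>t. \<bar>h t\<bar> \<le> C * (1 + \<bar>t\<bar>) ^ k"
  shows "sech_integrable h"
  using integrable_sech_density[of h C k] assms by (simp add: sech_integrable_def)

lemma sech_integrable_power [simp, intro]: "sech_integrable (\<lambda>t. t ^ k)"
proof (rule sech_integrable_polynomially_bounded[where C = 1 and k = k])
  show "\<bar>t ^ k\<bar> \<le> 1 * (1 + \<bar>t\<bar>) ^ k" for t :: real
    by (auto simp: power_abs intro!: power_mono)
qed simp

lemma sech_integrable_const [simp, intro]: "sech_integrable (\<lambda>_. c)"
  by (rule sech_integrable_polynomially_bounded[where C = "\<bar>c\<bar>" and k = 0]) auto

lemma sech_integrable_add [intro]:
  "sech_integrable f \<Longrightarrow> sech_integrable g \<Longrightarrow> sech_integrable (\<lambda>t. f t + g t)"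
  by (simp add: sech_integrable_def distrib_left)

lemma sech_integrable_diff [intro]:
  "sech_integrable f \<Longrightarrow> sech_integrable g \<Longrightarrow> sech_integrable (\<lambda>t. f t - g t)"
  by (simp add: sech_integrable_def right_diff_distrib)

lemma sech_integrable_cmult [intro]: "sech_integrable f \<Longrightarrow> sech_integrable (\<lambda>t. c * f t)"
  by (simp add: sech_integrable_def mult.left_commute)

lemma sech_integrable_sum [intro]:
  "(\<And>i. i \<in> I \<Longrightarrow> sech_integrable (f i)) \<Longrightarrow> sech_integrable (\<lambda>t. \<Sum>i\<in>I. f i t)"
  by (simp add: sech_integrable_def sum_distrib_left)

lemma sech_mean_add:
  "sech_integrable f \<Longrightarrow> sech_integrable g \<Longrightarrow>
     sech_mean (\<lambda>t. f t + g t) = sech_mean f + sech_mean g"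
  by (simp add: sech_integrable_def sech_mean_def distrib_left)

lemma sech_mean_diff:
  "sech_integrable f \<Longrightarrow> sech_integrable g \<Longrightarrow>
     sech_mean (\<lambda>t. f t - g t) = sech_mean f - sech_mean g"
  by (simp add: sech_integrable_def sech_mean_def right_diff_distrib)

lemma sech_mean_cmult: "sech_mean (\<lambda>t. c * f t) = c * sech_mean f"
  by (simp add: sech_mean_def mult.left_commute)

lemma sech_mean_sum:
  "(\<And>i. i \<in> I \<Longrightarrow> sech_integrable (f i)) \<Longrightarrow>
     sech_mean (\<lambda>t. \<Sum>i\<in>I. f i t) = (\<Sum>i\<in>I. sech_mean (f i))"
  by (simp add: sech_integrable_def sech_mean_def sum_distrib_left)

lemma sech_mean_mono:
  assumes "sech_integrable f" "sech_integrable g" "\<And>t. f t \<le> g t"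
  shows "sech_mean f \<le> sech_mean g"
  using assms sech_density_pos unfolding sech_mean_def sech_integrable_def
  by (intro integral_mono) (auto intro: mult_left_mono less_imp_le)

text \<open>A nonnegative integrand with integral zero vanishes almost everywhere, which a positive
  one cannot do. This strictness is the source of both strict bounds on
  \<open>\<Theta>\<close>.\<close>

lemma sech_mean_pos:
  assumes "sech_integrable h" "\<And>t. h t > 0"
  shows "sech_mean h > 0"
proof -
  have pos: "sech_density t * h t > 0" for t
    using sech_density_pos assms(2) by simp
  hence "sech_mean h \<ge> 0"
    unfolding sech_mean_def by (intro integral_nonneg_AE) (auto intro: less_imp_le)
  moreover have "sech_mean h \<noteq> 0"
  proof
    assume "sech_mean h = 0"
    hence "AE t in lborel. sech_density t * h t = 0"
      using assms(1) pos unfolding sech_mean_def sech_integrable_def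
      by (subst (asm) integral_nonneg_eq_0_iff_AE) (auto intro: less_imp_le)
    hence "AE t :: real in lborel. False"
      by (rule eventually_mono) (use pos in \<open>metis less_irrefl\<close>)
    thus False
      by (simp add: eventually_False ae_filter_eq_bot_iff)
  qed
  ultimately show ?thesis by simp
qed

text \<open>Real form of \<open>integral_sech_density_diff\<close>. The growth bound makes the
  values on each line integrable separately, so the integral of the difference splits.\<close>

lemma sech_mean_Re_diff:
  fixes f :: "complex \<Rightarrow> complex"
  assumes f: "f holomorphic_on {z. -1 < Re z \<and> Re z < 1}"
    and bound: "\<And>z. \<bar>Re z\<bar> \<le> 1/2 \<Longrightarrow> norm (f z) \<le> C * (1 + \<bar>Im z\<bar>) ^ k"
  shows "sech_mean (\<lambda>t. Re (f (Complex (1/2) t))) - sech_mean (\<lambda>t. Re (f (Complex (-(1/2)) t)))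
           = Re (deriv f 0)"
proof -
  have cont: "continuous_on A (\<lambda>t. f (Complex c t))" if "\<bar>c\<bar> \<le> 1/2" for c A
    by (rule continuous_on_compose2[OF holomorphic_on_imp_continuous_on[OF f] continuous_on_Complex_line])
       (use that in auto)
  have int: "integrable lborel (\<lambda>t. sech_density t *\<^sub>R f (Complex c t))" if "\<bar>c\<bar> \<le> 1/2" for c
    using bound[of "Complex c _"] that
    by (intro integrable_sech_density[where C = C and k = k] borel_measurable_continuous_onI cont) auto
  have Re_mean: "sech_mean (\<lambda>t. Re (f (Complex c t))) = Re (\<integral>t. sech_density t *\<^sub>R f (Complex c t) \<partial>lborel)"
    if "\<bar>c\<bar> \<le> 1/2" for c
    using integral_Re[OF int[OF that]] by (simp add: sech_mean_def)
  have "Re (deriv f 0) = Re (\<integral>t. sech_density t *\<^sub>R f (Complex (1/2) t) - sech_density t *\<^sub>R f (Complex (-(1/2)) t) \<partial>lborel)"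
    using integral_sech_density_diff[OF f bound] by (simp add: scaleR_diff_right)
  also have "\<dots> = Re ((\<integral>t. sech_density t *\<^sub>R f (Complex (1/2) t) \<partial>lborel) - (\<integral>t. sech_density t *\<^sub>R f (Complex (-(1/2)) t) \<partial>lborel))"
    by (subst Bochner_Integration.integral_diff) (use int in auto)
  finally show "sech_mean (\<lambda>t. Re (f (Complex (1/2) t))) - sech_mean (\<lambda>t. Re (f (Complex (-(1/2)) t)))
           = Re (deriv f 0)"
    by (simp add: Re_mean)
qed

text \<open>The real part of the mean of \<open>(iT) ^ j\<close>; the imaginary part vanishes by symmetry.\<close>

definition sech_moment :: "nat \<Rightarrow> real" where
  "sech_moment j = sech_mean (\<lambda>t. Re ((\<i> * of_real t) ^ j))"

lemma sech_integrable_Re_power: "sech_integrable (\<lambda>t. Re ((\<i> * of_real t) ^ j))"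
proof -
  have "Re ((\<i> * of_real t) ^ j) = Re (\<i> ^ j) * t ^ j" for t
    by (simp add: power_mult_distrib flip: of_real_power)
  thus ?thesis by (simp add: sech_integrable_cmult)
qed

lemma sech_moment_even: "sech_moment (2 * k) = (-1) ^ k * sech_mean (\<lambda>t. t ^ (2 * k))"
proof -
  have "Re ((\<i> * of_real t) ^ (2 * k)) = (-1) ^ k * t ^ (2 * k)" for t
  proof -
    have "(\<i> * of_real t) ^ (2 * k) = complex_of_real ((-1) ^ k * t ^ (2 * k))"
      by (simp add: power_mult_distrib power_mult power_minus[of "(of_real t)\<^sup>2"])
    thus ?thesis by (simp only: Re_complex_of_real)
  qed
  thus ?thesis by (simp add: sech_moment_def sech_mean_cmult)
qed

lemma sech_mean_Re_Complex_power:
  fixes c :: real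
  shows "sech_mean (\<lambda>t. Re (Complex c t ^ j)) = (\<Sum>l\<le>j. real (j choose l) * c ^ (j - l) * sech_moment l)"
proof -
  have "Re (Complex c t ^ j) = (\<Sum>l\<le>j. (real (j choose l) * c ^ (j - l)) * Re ((\<i> * of_real t) ^ l))" for t
  proof -
    have "Complex c t ^ j = (\<i> * of_real t + of_real c) ^ j"
      by (simp add: Complex_eq add.commute)
    also have "\<dots> = (\<Sum>l\<le>j. of_real (real (j choose l) * c ^ (j - l)) * (\<i> * of_real t) ^ l)"
      unfolding binomial_ring by (intro sum.cong) (auto simp: mult_ac)
    finally show ?thesis by (simp only: Re_sum times_complex.sel Re_complex_of_real Im_complex_of_real mult_zero_left diff_zero)
  qed
  thus ?thesis
    by (simp add: sech_mean_sum sech_mean_cmult sech_integrable_cmult sech_integrable_Re_power sech_moment_def)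
qed

text \<open>The contour identity for z^j, expanded binomially on both lines. The term l = j cancels,
  so for j > 0 the instance j determines the moment of order j - 1.\<close>

lemma sech_moment_recurrence:
  "(\<Sum>l\<le>j. real (j choose l) * ((1/2) ^ (j - l) - (-(1/2)) ^ (j - l)) * sech_moment l) = (if j = 1 then 1 else 0)"
proof -
  have "(\<Sum>l\<le>j. real (j choose l) * ((1/2) ^ (j - l) - (-(1/2)) ^ (j - l)) * sech_moment l) =
        sech_mean (\<lambda>t. Re (Complex (1/2) t ^ j)) - sech_mean (\<lambda>t. Re (Complex (-(1/2)) t ^ j))"
    unfolding sech_mean_Re_Complex_power sum_subtractf [symmetric]
    by (intro sum.cong) (auto simp: algebra_simps)
  also have "\<dots> = Re (deriv (\<lambda>z. z ^ j) 0)"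
  proof (rule sech_mean_Re_diff[where C = 1 and k = j])
    fix z :: complex assume "\<bar>Re z\<bar> \<le> 1/2"
    hence "norm z \<le> 1 + \<bar>Im z\<bar>"
      using cmod_le[of z] by linarith
    thus "norm (z ^ j) \<le> 1 * (1 + \<bar>Im z\<bar>) ^ j"
      by (simp add: norm_power power_mono)
  qed (intro holomorphic_intros)
  \<comment> \<open>For j = 0 the exponent truncates to 0, but the factor \<open>of_nat j\<close> is
    0; for j = 1 the value is 0^0 = 1.\<close>
  also have "deriv (\<lambda>z. z ^ j) 0 = of_nat j * (0::complex) ^ (j - 1)"
    by (intro DERIV_imp_deriv) (auto intro!: derivative_eq_intros)
  also have "Re \<dots> = (if j = 1 then 1 else 0)"
    by (cases "j = 1"; cases j) auto
  finally show ?thesis .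
qed

text \<open>Normalization of the density: in the instance j = 1 only the term l = 0
  survives.\<close>

lemma sech_moment_0 [simp]: "sech_moment 0 = 1"
  using sech_moment_recurrence[of 1] by simp

lemma sech_mean_const: "sech_mean (\<lambda>_. c) = c"
  using sech_moment_even[of 0] sech_mean_cmult[of c "\<lambda>_. 1"] by simp

lemma sech_moment_eq_bernoulli_poly: "sech_moment j = bernoulli_poly j (1/2)"
proof -
  text \<open>The recurrence says \<open>2 sinh (x / 2) M(x) = x\<close> for the generating function \<open>M\<close>.\<close>
  define M where "M = Abs_fps (\<lambda>j. sech_moment j / fact j)"
  have "M * (fps_exp (1/2) - fps_exp (-(1/2))) = fps_X"
  proof (rule fps_ext)
    fix n
    have "fps_nth (M * (fps_exp (1/2) - fps_exp (-(1/2)))) n =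
      (\<Sum>l\<le>n. real (n choose l) * ((1/2) ^ (n - l) - (-(1/2)) ^ (n - l)) * sech_moment l) / fact n"
      unfolding fps_mult_nth sum_divide_distrib atLeast0AtMost
      by (intro sum.cong refl) (simp add: M_def binomial_fact field_simps)
    also have "\<dots> = fps_nth fps_X n"
      unfolding sech_moment_recurrence by simp
    finally show "fps_nth (M * (fps_exp (1/2) - fps_exp (-(1/2)))) n = fps_nth fps_X n" .
  qed
  \<comment> \<open>The factor exp (x/2) turns 2 sinh (x/2) into exp x - 1, the divisor of the
    Bernoulli generating function, and supplies the numerator for the argument 1/2.\<close>
  hence "M * ((fps_exp (1/2) - fps_exp (-(1/2))) * fps_exp (1/2)) = fps_X * fps_exp (1/2)"
    by (simp only: mult.assoc [symmetric])
  also have "(fps_exp (1/2) - fps_exp (-(1/2))) * fps_exp (1/2) = fps_exp (1::real) - 1"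
    unfolding left_diff_distrib fps_exp_add_mult [symmetric] by simp
  finally have "M * (fps_exp 1 - 1) = fps_X * fps_exp (1/2)" .
  moreover have "fps_exp (1::real) - 1 \<noteq> 0"
  proof
    assume "fps_exp (1::real) - 1 = 0"
    hence "fps_nth (fps_exp (1::real) - 1) 1 = 0" by simp
    thus False by simp
  qed
  ultimately have "fps_X * fps_exp (1/2) / (fps_exp 1 - 1) = M"
    by (metis nonzero_mult_div_cancel_right)
  thus ?thesis
    by (simp add: bernoulli_poly_def M_def)
qed

lemma sech_mean_even_power: "sech_mean (\<lambda>t. t ^ (2 * k)) = (-1) ^ k * bernoulli_poly (2 * k) (1/2)"
  using sech_moment_even[of k] sech_moment_eq_bernoulli_poly[of "2 * k"]
  by (cases "even k") auto

text \<open>Write (T^2 + 1/4) / 2 as (1 + 4 T^2) / 8 and expand: the even moments contribute the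
  signs that turn 4^k into (-4)^k. At p = 0 both sides of the second claim are 0, by division by
  zero. The divisor \<open>c\<close> is general so that 2m can be used as well.\<close>

lemma sech_integrable_ramanujan: "sech_integrable (\<lambda>t. ((t\<^sup>2 + 1/4) / c) ^ p)"
  and ramanujan_coeff_eq_sech_mean:
    "ramanujan_coeff p = (-1) ^ (p - 1) / (2 * real p) * sech_mean (\<lambda>t. ((t\<^sup>2 + 1/4) / 2) ^ p)"
proof -
  have *: "((t\<^sup>2 + 1/4) / c) ^ p = (\<Sum>k\<le>p. (real (p choose k) * 4 ^ k / (4 * c) ^ p) * t ^ (2 * k))" for t c :: real
  proof -
    have "((t\<^sup>2 + 1/4) / c) ^ p = (4 * t\<^sup>2 + 1) ^ p / (4 * c) ^ p"
    proof -
      have "(t\<^sup>2 + 1/4) / c = (4 * t\<^sup>2 + 1) / (4 * c)"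
        by (cases "c = 0") (simp_all add: field_simps)
      thus ?thesis by (simp only: power_divide)
    qed
    also have "(4 * t\<^sup>2 + 1) ^ p = (\<Sum>k\<le>p. real (p choose k) * 4 ^ k * t ^ (2 * k))"
      unfolding binomial_ring by (intro sum.cong) (auto simp: power_mult_distrib power_mult)
    finally show ?thesis by (simp add: sum_divide_distrib)
  qed
  show "sech_integrable (\<lambda>t. ((t\<^sup>2 + 1/4) / c) ^ p)"
    unfolding * by (intro sech_integrable_sum sech_integrable_cmult sech_integrable_power)
  have "sech_mean (\<lambda>t. ((t\<^sup>2 + 1/4) / 2) ^ p) =
      (\<Sum>k\<le>p. (real (p choose k) * 4 ^ k / 8 ^ p) * ((-1) ^ k * bernoulli_poly (2 * k) (1/2)))"
    unfolding * by (simp only: sech_mean_sum sech_mean_cmult sech_integrable_cmult sech_integrable_power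
      sech_mean_even_power) simp
  also have "\<dots> = (\<Sum>k\<le>p. real (p choose k) * (-4) ^ k * bernoulli_poly (2 * k) (1/2)) / 8 ^ p"
    unfolding sum_divide_distrib
    by (intro sum.cong) (auto simp: power_minus[of 4] mult_ac)
  \<comment> \<open>The isolated 1 in \<open>ramanujan_coeff\<close> is the term k = 0, since
    B_0(1/2) = 1.\<close>
  also have "(\<Sum>k\<le>p. real (p choose k) * (-4) ^ k * bernoulli_poly (2 * k) (1/2)) =
      1 + (\<Sum>k=1..p. real (p choose k) * (-4) ^ k * bernoulli_poly (2 * k) (1/2))"
    using sech_moment_eq_bernoulli_poly[of 0]
    by (simp add: atMost_atLeast0 sum.atLeast_Suc_atMost)
  finally show "ramanujan_coeff p = (-1) ^ (p - 1) / (2 * real p) * sech_mean (\<lambda>t. ((t\<^sup>2 + 1/4) / 2) ^ p)"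
    unfolding ramanujan_coeff_def by simp
qed

subsection \<open>Harmonic numbers as logarithmic means\<close>

text \<open>The mean of ln |x + iT|, that is, of the real part of \<open>Ln\<close> on a vertical
  line. For x > 0 this is the digamma function at x + 1/2.\<close>

definition sech_log_mean :: "real \<Rightarrow> real" where
  "sech_log_mean x = sech_mean (\<lambda>t. ln (x\<^sup>2 + t\<^sup>2) / 2)"

lemma abs_ln_le:
  assumes "x > (0::real)"
  shows "\<bar>ln x\<bar> \<le> x + 1 / x"
proof -
  have "1 / x > 0" using assms by simp
  moreover have "ln (1 / x) = - ln x" using assms by (simp add: ln_div)
  ultimately show ?thesis
    using assms ln_le_minus_one[of x] ln_le_minus_one[of "1 / x"] by linarith
qed

text \<open>Supplies the growth hypothesis of the contour identity for the logarithm. The constant 2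
  bounds 1 / |w|, and pi bounds the argument.\<close>

lemma norm_Ln_le:
  assumes "Re w \<ge> 1/2"
  shows "norm (Ln w) \<le> (\<bar>Re w\<bar> + 2 + pi) * (1 + \<bar>Im w\<bar>)"
proof -
  have w: "w \<noteq> 0" "norm w \<ge> 1/2"
    using assms complex_Re_le_cmod[of w] by auto
  have "norm (Ln w) \<le> \<bar>Re (Ln w)\<bar> + \<bar>Im (Ln w)\<bar>"
    by (rule cmod_le)
  also have "\<bar>Im (Ln w)\<bar> \<le> pi"
    using w mpi_less_Im_Ln[of w] Im_Ln_le_pi[of w] by linarith
  also have "\<bar>Re (Ln w)\<bar> \<le> norm w + 1 / norm w"
    using w abs_ln_le[of "norm w"] by simp
  also have "1 / norm w \<le> 2"
    using w by (simp add: field_simps)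
  also have "norm w \<le> \<bar>Re w\<bar> + \<bar>Im w\<bar>"
    by (rule cmod_le)
  also have "\<bar>Re w\<bar> + \<bar>Im w\<bar> + 2 + pi \<le> (\<bar>Re w\<bar> + 2 + pi) * (1 + \<bar>Im w\<bar>)"
  proof -
    have "0 \<le> (\<bar>Re w\<bar> + 1 + pi) * \<bar>Im w\<bar>" by simp
    thus ?thesis by (simp add: algebra_simps)
  qed
  finally show ?thesis by simp
qed

text \<open>Factor out x^2, leaving ln (1 + (t/x)^2) / 2, and use 0 \<le> ln (1 + u) \<le> u for u
  \<ge> 0. The two bounds force \<open>sech_log_mean x - ln x\<close> to tend to 0 as x
  grows.\<close>

lemma
  assumes "x > 0"
  shows sech_integrable_log: "sech_integrable (\<lambda>t. ln (x\<^sup>2 + t\<^sup>2) / 2)"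
    and sech_log_mean_le: "sech_log_mean x - ln x \<le> sech_mean (\<lambda>t. t\<^sup>2) / (2 * x\<^sup>2)"
    and sech_log_mean_ge: "sech_log_mean x - ln x \<ge> 0"
proof -
  have eq: "ln (x\<^sup>2 + t\<^sup>2) / 2 = ln x + ln (1 + (t / x)\<^sup>2) / 2" for t
  proof -
    have "x\<^sup>2 + t\<^sup>2 = x\<^sup>2 * (1 + (t / x)\<^sup>2)"
      using assms by (simp add: field_simps)
    also have "ln \<dots> = 2 * ln x + ln (1 + (t / x)\<^sup>2)"
      using assms by (subst ln_mult_pos) (auto simp: ln_realpow add_pos_nonneg)
    finally show ?thesis by simp
  qed
  have le: "0 \<le> ln (1 + (t / x)\<^sup>2) / 2" "ln (1 + (t / x)\<^sup>2) / 2 \<le> inverse (2 * x\<^sup>2) * t\<^sup>2" for t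
    using ln_add_one_self_le_self[of "(t / x)\<^sup>2"] by (auto simp: field_simps)
  have int: "sech_integrable (\<lambda>t. ln (1 + (t / x)\<^sup>2) / 2)"
  proof (rule sech_integrable_polynomially_bounded[where C = "inverse (2 * x\<^sup>2)" and k = 2])
    fix t :: real
    have "inverse (2 * x\<^sup>2) * t\<^sup>2 \<le> inverse (2 * x\<^sup>2) * (1 + \<bar>t\<bar>)\<^sup>2"
      by (intro mult_left_mono) (auto simp: power2_eq_square algebra_simps)
    thus "\<bar>ln (1 + (t / x)\<^sup>2) / 2\<bar> \<le> inverse (2 * x\<^sup>2) * (1 + \<bar>t\<bar>)\<^sup>2"
      using le[of t] by linarith
  qed measurable
  show "sech_integrable (\<lambda>t. ln (x\<^sup>2 + t\<^sup>2) / 2)"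
    unfolding eq by (intro sech_integrable_add sech_integrable_const int)
  have mean: "sech_log_mean x - ln x = sech_mean (\<lambda>t. ln (1 + (t / x)\<^sup>2) / 2)"
    unfolding sech_log_mean_def eq by (subst sech_mean_add) (auto simp: int sech_mean_const)
  have "sech_mean (\<lambda>t. ln (1 + (t / x)\<^sup>2) / 2) \<le> sech_mean (\<lambda>t. inverse (2 * x\<^sup>2) * t\<^sup>2)"
    by (intro sech_mean_mono int sech_integrable_cmult sech_integrable_power le)
  thus "sech_log_mean x - ln x \<le> sech_mean (\<lambda>t. t\<^sup>2) / (2 * x\<^sup>2)"
    unfolding mean sech_mean_cmult by (simp add: field_simps)
  have "sech_mean (\<lambda>_. 0) \<le> sech_mean (\<lambda>t. ln (1 + (t / x)\<^sup>2) / 2)"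
    by (intro sech_mean_mono int sech_integrable_const le)
  thus "sech_log_mean x - ln x \<ge> 0"
    unfolding mean by (simp add: sech_mean_const)
qed

text \<open>The contour identity for \<open>Ln (a + z)\<close>, whose derivative at 0 is 1/a. For a
  \<ge> 1 the open strip, shifted by a, avoids the branch cut.\<close>

lemma sech_log_mean_diff:
  assumes "a \<ge> 1"
  shows "sech_log_mean (a + 1/2) - sech_log_mean (a - 1/2) = 1 / a"
proof -
  have Re: "Re (Ln (of_real a + Complex c t)) = ln ((a + c)\<^sup>2 + t\<^sup>2) / 2" if "\<bar>c\<bar> \<le> 1/2" for c t
  proof -
    have "of_real a + Complex c t \<noteq> 0" "(a + c)\<^sup>2 + t\<^sup>2 > 0"
      using assms that by (auto simp: complex_eq_iff add_pos_nonneg)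
    thus ?thesis by (simp add: cmod_def ln_sqrt)
  qed
  have "sech_mean (\<lambda>t. Re (Ln (of_real a + Complex (1/2) t))) -
        sech_mean (\<lambda>t. Re (Ln (of_real a + Complex (-(1/2)) t))) = Re (deriv (\<lambda>z. Ln (of_real a + z)) 0)"
  \<comment> \<open>The constant is that of \<open>norm_Ln_le\<close> with |a + Re z| \<le> a +
    1/2.\<close>
  proof (rule sech_mean_Re_diff[where C = "a + 5/2 + pi" and k = 1])
    show "(\<lambda>z. Ln (of_real a + z)) holomorphic_on {z. -1 < Re z \<and> Re z < 1}"
      using assms by (intro holomorphic_intros) (auto simp: complex_nonpos_Reals_iff)
    fix z :: complex assume z: "\<bar>Re z\<bar> \<le> 1/2"
    have "norm (Ln (of_real a + z)) \<le> (\<bar>a + Re z\<bar> + 2 + pi) * (1 + \<bar>Im z\<bar>)"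
      using norm_Ln_le[of "of_real a + z"] assms z by simp
    also have "\<dots> \<le> (a + 5/2 + pi) * (1 + \<bar>Im z\<bar>)"
      using assms z by (intro mult_right_mono) auto
    finally show "norm (Ln (of_real a + z)) \<le> (a + 5/2 + pi) * (1 + \<bar>Im z\<bar>) ^ 1" by simp
  qed
  also have "deriv (\<lambda>z. Ln (of_real a + z)) 0 = of_real (1 / a)"
    using assms by (intro DERIV_imp_deriv) (auto intro!: derivative_eq_intros simp: complex_nonpos_Reals_iff divide_inverse)
  finally show ?thesis
    by (simp add: Re sech_log_mean_def del: Re_Ln)
qed

text \<open>Telescoping determines everything up to the constant \<open>sech_log_mean (1/2)\<close>.
  Comparison with ln n at infinity identifies that constant as minus Euler's constant.\<close>

lemma harm_eq_sech_log_mean: "harm n = sech_log_mean (real n + 1/2) + euler_mascheroni"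
proof -
  have harm: "harm n = sech_log_mean (real n + 1/2) - sech_log_mean (1/2)" for n
  proof (induction n)
    case (Suc n)
    have *: "real (Suc n) - 1/2 = real n + 1/2" by simp
    have "sech_log_mean (real (Suc n) + 1/2) - sech_log_mean (real n + 1/2) = 1 / real (Suc n)"
      using sech_log_mean_diff[of "real (Suc n)"] unfolding * by linarith
    moreover have "harm (Suc n) = harm n + 1 / real (Suc n)"
      by (simp add: harm_Suc inverse_eq_divide)
    ultimately show ?case using Suc.IH by linarith
  qed (simp add: harm_def)
  have "(\<lambda>n. sech_log_mean (real n + 1/2) - ln (real n + 1/2)) \<longlonglongrightarrow> 0"
  proof (rule tendsto_sandwich)
    show "\<forall>\<^sub>F n in sequentially. 0 \<le> sech_log_mean (real n + 1/2) - ln (real n + 1/2)"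
      by (intro always_eventually allI sech_log_mean_ge) auto
    show "\<forall>\<^sub>F n in sequentially. sech_log_mean (real n + 1/2) - ln (real n + 1/2)
            \<le> sech_mean (\<lambda>t. t\<^sup>2) / (2 * (real n + 1/2)\<^sup>2)"
      by (intro always_eventually allI sech_log_mean_le) auto
    have "(\<lambda>n. 1 / (2 * (real n + 1/2)\<^sup>2)) \<longlonglongrightarrow> 0"
      by real_asymp
    from tendsto_mult_right_zero[OF this, of "sech_mean (\<lambda>t. t\<^sup>2)"]
    show "(\<lambda>n. sech_mean (\<lambda>t. t\<^sup>2) / (2 * (real n + 1/2)\<^sup>2)) \<longlonglongrightarrow> 0"
      by simp
  qed auto
  moreover have "(\<lambda>n. ln (real n + 1/2) - ln (real n)) \<longlonglongrightarrow> 0"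
    by real_asymp
  ultimately have "(\<lambda>n. (sech_log_mean (real n + 1/2) - ln (real n + 1/2)) +
      (ln (real n + 1/2) - ln (real n)) - sech_log_mean (1/2)) \<longlonglongrightarrow> 0 + 0 - sech_log_mean (1/2)"
    by (intro tendsto_intros)
  hence "(\<lambda>n. harm n - ln (real n)) \<longlonglongrightarrow> - sech_log_mean (1/2)"
    by (simp add: harm algebra_simps)
  with euler_mascheroni_LIMSEQ have "euler_mascheroni = - sech_log_mean (1/2)"
    by (intro LIMSEQ_unique)
  thus ?thesis
    by (simp add: harm)
qed

section \<open>Strict enveloping of ln (1 + y) by its Taylor polynomials\<close>

definition ln_remainder :: "nat \<Rightarrow> real \<Rightarrow> real" where
  "ln_remainder r y = (-1) ^ r * (ln (1 + y) - (\<Sum>p=1..r. (-1) ^ (p - 1) * y ^ p / real p))"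

lemma ln_eq_ln_remainder:
  "ln (1 + y) = (\<Sum>p=1..r. (-1) ^ (p - 1) * y ^ p / real p) + (-1) ^ r * ln_remainder r y"
  by (simp add: ln_remainder_def flip: mult.assoc power_add)

text \<open>Once all remainders are known to be positive, this traps the r-th one strictly between 0
  and the first omitted term. It also drives the induction for the derivative.\<close>

lemma ln_remainder_Suc: "ln_remainder (Suc r) y = y ^ Suc r / real (Suc r) - ln_remainder r y"
  by (simp add: ln_remainder_def algebra_simps)

text \<open>With the sign (-1)^r built in, the derivative is x^r / (1 + x) for every r, which is
  positive for x > 0, and the remainder vanishes at 0.\<close>

lemma ln_remainder_pos:
  assumes "y > 0"
  shows "ln_remainder r y > 0"
proof -
  have deriv: "(ln_remainder r has_real_derivative x ^ r / (1 + x)) (at x)" if "x \<ge> 0" for x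
  proof (induction r)
    case 0
    show ?case
      unfolding ln_remainder_def using that by (auto intro!: derivative_eq_intros simp: field_simps)
  next
    case (Suc r)
    have "((\<lambda>y. y ^ Suc r / real (Suc r)) has_real_derivative x ^ r) (at x)"
      using DERIV_cdivide[OF DERIV_pow[of "Suc r" x], of "real (Suc r)"] by simp
    hence "((\<lambda>y. y ^ Suc r / real (Suc r) - ln_remainder r y) has_real_derivative
             x ^ r - x ^ r / (1 + x)) (at x)"
      by (intro DERIV_diff Suc)
    moreover have "x ^ r - x ^ r / (1 + x) = x ^ Suc r / (1 + x)"
      using that by (simp add: field_simps)
    ultimately show ?case
      by (simp only: ln_remainder_Suc[abs_def])
  qed
  have "ln_remainder r 0 < ln_remainder r y"
  proof (rule DERIV_pos_imp_increasing_open[OF assms])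
    show "\<exists>d. (ln_remainder r has_real_derivative d) (at x) \<and> 0 < d" if "0 < x" "x < y" for x
      using that by (intro exI[of _ "x ^ r / (1 + x)"] conjI deriv) auto
    show "continuous_on {0..y} (ln_remainder r)"
      by (intro continuous_at_imp_continuous_on ballI DERIV_isCont[OF deriv]) auto
  qed
  moreover have "ln_remainder r 0 = 0"
    by (auto simp: ln_remainder_def intro!: sum.neutral)
  ultimately show ?thesis by simp
qed

section \<open>The enveloping expansion in powers of 1/m\<close>

theorem theorem1:
  fixes n r :: nat and m :: real
  assumes "n \<ge> 1"
    and "m = real n * (real n + 1) / 2"
    and "r \<ge> 1"
  shows "\<exists>\<Theta>::real. 0 < \<Theta> \<and> \<Theta> < 1 \<and>
           (\<Sum>k = 1..n. 1 / real k) =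
             1 / 2 * ln (2 * m) + euler_mascheroni
               + (\<Sum>p = 1..r. ramanujan_coeff p / m ^ p)
               + \<Theta> * (ramanujan_coeff (r + 1) / m ^ (r + 1))"
proof -
  have m: "m > 0" unfolding assms(2) using assms(1) by simp
  define y where "y = (\<lambda>t. (t\<^sup>2 + 1/4) / (2 * m))"
  define N where "N = real n + 1/2"
  have y: "y t > 0" for t
    using m by (auto simp: y_def intro!: divide_pos_pos add_nonneg_pos)
  have "N > 0" by (simp add: N_def)
  have int_y: "sech_integrable (\<lambda>t. y t ^ p)" for p
    unfolding y_def by (rule sech_integrable_ramanujan)
  have coeff: "ramanujan_coeff p / m ^ p = (-1) ^ (p - 1) / (2 * real p) * sech_mean (\<lambda>t. y t ^ p)" for p
  proof -
    have "y t ^ p = inverse (m ^ p) * ((t\<^sup>2 + 1/4) / 2) ^ p" for t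
    proof -
      have "y t = inverse m * ((t\<^sup>2 + 1/4) / 2)"
        using m by (simp add: y_def field_simps)
      thus ?thesis by (simp only: power_mult_distrib power_inverse)
    qed
    hence "sech_mean (\<lambda>t. y t ^ p) = inverse (m ^ p) * sech_mean (\<lambda>t. ((t\<^sup>2 + 1/4) / 2) ^ p)"
      by (simp only: sech_mean_cmult)
    thus ?thesis
      unfolding ramanujan_coeff_eq_sech_mean by (simp only: divide_inverse mult_ac)
  qed
  have ln_y: "ln (1 + y t) = 2 * (ln (N\<^sup>2 + t\<^sup>2) / 2) - ln (2 * m)" for t
  proof -
    \<comment> \<open>Because N^2 = n(n + 1) + 1/4 = 2m + 1/4, the shift 1/4 in \<open>y\<close> is
      exactly absorbed.\<close>
    have "1 + y t = (N\<^sup>2 + t\<^sup>2) / (2 * m)"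
      using m unfolding y_def N_def
      by (simp add: add_divide_distrib) (simp add: assms(2) power2_eq_square field_simps)
    moreover have "N\<^sup>2 + t\<^sup>2 > 0"
      using \<open>N > 0\<close> by (simp add: add_pos_nonneg)
    ultimately show ?thesis
      using m by (simp add: ln_divide_pos)
  qed
  have int_ln: "sech_integrable (\<lambda>t. ln (1 + y t))"
    unfolding ln_y using \<open>N > 0\<close>
    by (intro sech_integrable_diff sech_integrable_cmult sech_integrable_log sech_integrable_const)
  have int_term: "sech_integrable (\<lambda>t. (-1) ^ (p - 1) * y t ^ p / real p)" for p
    using sech_integrable_cmult[OF int_y, of "(-1) ^ (p - 1) / real p" p] by simp
  have int_rem: "sech_integrable (\<lambda>t. ln_remainder s (y t))" for s
    unfolding ln_remainder_def
    by (intro sech_integrable_cmult sech_integrable_diff sech_integrable_sum int_ln int_term)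
  \<comment> \<open>\<open>A\<close> is the mean remainder and \<open>B\<close> the mean of the
    first omitted term, both without sign and for ln (1 + y) rather than half of it.\<close>
  define A where "A = sech_mean (\<lambda>t. ln_remainder r (y t))"
  define B where "B = sech_mean (\<lambda>t. y t ^ Suc r) / real (Suc r)"
  have "A > 0"
    unfolding A_def by (intro sech_mean_pos int_rem ln_remainder_pos y)
  \<comment> \<open>Positivity of the next remainder is the upper bound
    \<open>A < B\<close>.\<close>
  have "0 < sech_mean (\<lambda>t. ln_remainder (Suc r) (y t))"
    by (intro sech_mean_pos int_rem ln_remainder_pos y)
  also have "\<dots> = sech_mean (\<lambda>t. 1 / real (Suc r) * y t ^ Suc r - ln_remainder r (y t))"
    by (simp add: ln_remainder_Suc)
  also have "\<dots> = B - A"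
    by (subst sech_mean_diff)
       (simp_all only: int_rem sech_integrable_cmult int_y sech_mean_cmult A_def B_def, simp)
  finally have "A < B" by simp
  have "2 * sech_log_mean N - ln (2 * m) = sech_mean (\<lambda>t. ln (1 + y t))"
    unfolding ln_y sech_log_mean_def using \<open>N > 0\<close>
    by (simp only: sech_mean_diff sech_mean_cmult sech_mean_const sech_integrable_cmult
          sech_integrable_log sech_integrable_const)
  also have "\<dots> = sech_mean (\<lambda>t. (\<Sum>p=1..r. (-1) ^ (p - 1) * y t ^ p / real p) +
                      (-1) ^ r * ln_remainder r (y t))"
    by (subst ln_eq_ln_remainder[of _ r]) simp
  also have "\<dots> = sech_mean (\<lambda>t. \<Sum>p=1..r. (-1) ^ (p - 1) * y t ^ p / real p) + (-1) ^ r * A"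
    by (simp only: sech_mean_add sech_integrable_sum int_term sech_integrable_cmult int_rem sech_mean_cmult A_def)
  also have "sech_mean (\<lambda>t. \<Sum>p=1..r. (-1) ^ (p - 1) * y t ^ p / real p) =
               (\<Sum>p=1..r. sech_mean (\<lambda>t. (-1) ^ (p - 1) * y t ^ p / real p))"
    by (rule sech_mean_sum) (rule int_term)
  also have "\<dots> = (\<Sum>p=1..r. 2 * (ramanujan_coeff p / m ^ p))"
  proof (rule sum.cong)
    fix p
    show "sech_mean (\<lambda>t. (-1) ^ (p - 1) * y t ^ p / real p) = 2 * (ramanujan_coeff p / m ^ p)"
      using sech_mean_cmult[of "(-1) ^ (p - 1) / real p" "\<lambda>t. y t ^ p"] by (simp add: coeff)
  qed simp
  finally have log_mean: "sech_log_mean N =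
      1 / 2 * ln (2 * m) + (\<Sum>p=1..r. ramanujan_coeff p / m ^ p) + (-1) ^ r * A / 2"
    unfolding sum_distrib_left [symmetric] by simp
  \<comment> \<open>The sign exponent (r + 1) - 1 is r, so the next term of the expansion has the
    same sign as the error.\<close>
  have last_term: "ramanujan_coeff (r + 1) / m ^ (r + 1) = (-1) ^ r * B / 2"
    unfolding coeff B_def by simp
  \<comment> \<open>Signs and halves cancel in the quotient of error and next term, which leaves
    \<open>A / B\<close> as the witness for \<open>\<Theta>\<close>.\<close>
  have "(-1) ^ r * A / 2 = A / B * (ramanujan_coeff (r + 1) / m ^ (r + 1))"
    unfolding last_term using \<open>A > 0\<close> \<open>A < B\<close> by simp
  moreover have "(\<Sum>k = 1..n. 1 / real k) = sech_log_mean N + euler_mascheroni"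
    using harm_eq_sech_log_mean[of n] by (simp add: harm_def N_def inverse_eq_divide)
  ultimately show ?thesis
    using \<open>A > 0\<close> \<open>A < B\<close> log_mean by (intro exI[of _ "A / B"]) simp
qed

end
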